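(* Let $G$ be a finite non-abelian group and let $k$ be a positive integer. Then $G$ is an $LC$-nilpotent group of maximal $LC$-class $k$ if and only if $k=2$ and $G$ is a non-abelian group of order $pq$, where $p<q$ are prime numbers.
   Context: $o(x)$ denotes the order of $x$. For a finite group $G$, $LCM(G)$ is the set of all $x\in G$ such that $o(x^n y)$ divides $\mathrm{lcm}(o(x^n),o(y))$ for all $y\in G$ and all integers $n$; $LC(G)$ is the subgroup generated by $LCM(G)$ (a characteristic subgroup). Put $LC_0(G)=1$, $LC_1(G)=LC(G)$, and for $i\ge 2$ define $LC_i(G)$ by $LC_i(G)/LC_{i-1}(G)=LC(G/LC_{i-1}(G))$. $G$ is $LC$-nilpotent if there is $k$ with $LC_k(G)=G$ and $LC_i(G)/LC_{i-1}(G)$ nilpotent for all $i=1,\dots,k$; it has $LC$-class $k$ if $LC_k(G)=G$ and $LC_{k-1}(G)<LC_k(G)$. An $LC$-nilpotent group $G$ of $LC$-class $k$ is of maximal $LC$-class (of maximal $LC$-class $k$) if $|LC_i(G)/LC_{i-1}(G)|$ is a prime number for each $i=1,\dots,k$. *)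

theory Defs
  imports "HOL-Algebra.Algebra"
begin

definition LCM_set :: "('a, 'b) monoid_scheme \<Rightarrow> 'a set" where
  "LCM_set G = {x \<in> carrier G. \<forall>y \<in> carrier G. \<forall>n::int.
     group.ord G (x [^]\<^bsub>G\<^esub> n \<otimes>\<^bsub>G\<^esub> y) dvd
       lcm (group.ord G (x [^]\<^bsub>G\<^esub> n)) (group.ord G y)}"

definition LC :: "('a, 'b) monoid_scheme \<Rightarrow> 'a set" where
  "LC G = generate G (LCM_set G)"

text \<open>Each term of the series is a subset of the group itself, so for \<open>i \<ge> 2\<close> the term \<open>LC\<^sub>i(G)\<close>
  is the full preimage of \<open>LC(G/LC\<^sub>i\<^sub>-\<^sub>1(G))\<close> under the projection that maps \<open>x\<close> to its coset.\<close>

fun LC_series :: "('a, 'b) monoid_scheme \<Rightarrow> nat \<Rightarrow> 'a set" where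
  "LC_series G 0 = {\<one>\<^bsub>G\<^esub>}"
| "LC_series G (Suc 0) = LC G"
| "LC_series G (Suc (Suc i)) =
     {x \<in> carrier G. LC_series G (Suc i) #>\<^bsub>G\<^esub> x \<in> LC (G Mod LC_series G (Suc i))}"

text \<open>The factor \<open>LC\<^sub>i(G)/LC\<^sub>i\<^sub>-\<^sub>1(G)\<close>, used for \<open>i \<ge> 1\<close> only.\<close>

definition LC_factor :: "('a, 'b) monoid_scheme \<Rightarrow> nat \<Rightarrow> 'a set monoid" where
  "LC_factor G i = (G\<lparr>carrier := LC_series G i\<rparr>) Mod LC_series G (i - 1)"

fun lower_central :: "('a, 'b) monoid_scheme \<Rightarrow> nat \<Rightarrow> 'a set" where
  "lower_central G 0 = carrier G"
| "lower_central G (Suc n) = generate G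
     {x \<otimes>\<^bsub>G\<^esub> y \<otimes>\<^bsub>G\<^esub> inv\<^bsub>G\<^esub> x \<otimes>\<^bsub>G\<^esub> inv\<^bsub>G\<^esub> y | x y. x \<in> lower_central G n \<and> y \<in> carrier G}"

definition nilpotent_group :: "('a, 'b) monoid_scheme \<Rightarrow> bool" where
  "nilpotent_group G \<longleftrightarrow> group G \<and> (\<exists>n. lower_central G n = {\<one>\<^bsub>G\<^esub>})"

definition LC_nilpotent :: "('a, 'b) monoid_scheme \<Rightarrow> bool" where
  "LC_nilpotent G \<longleftrightarrow>
     (\<exists>k. LC_series G k = carrier G \<and> (\<forall>i \<in> {1..k}. nilpotent_group (LC_factor G i)))"

definition has_LC_class :: "('a, 'b) monoid_scheme \<Rightarrow> nat \<Rightarrow> bool" where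
  "has_LC_class G k \<longleftrightarrow>
     LC_series G k = carrier G \<and> LC_series G (k - 1) \<subset> LC_series G k"

definition maximal_LC_class :: "('a, 'b) monoid_scheme \<Rightarrow> nat \<Rightarrow> bool" where
  "maximal_LC_class G k \<longleftrightarrow> LC_nilpotent G \<and> has_LC_class G k \<and>
     (\<forall>i \<in> {1..k}. Factorial_Ring.prime (order (LC_factor G i)))"

end

theory Submission
  imports Defs "HOL-Number_Theory.Residues"
begin

text \<open>
  The two lowest classes are a matter of counting. The factors \<open>LC\<^sub>i(G)/LC\<^sub>i\<^sub>-\<^sub>1(G)\<close> have prime orders, so class
  \<open>1\<close> means that \<open>G\<close> has prime order and is abelian, while class \<open>2\<close> means that \<open>G\<close> has order \<open>q p\<close> with a normal
  subgroup \<open>LC(G)\<close> of prime order; the two primes differ because a group of order \<open>p\<^sup>2\<close> is abelian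
  (\<open>card_prime_square_comm\<close>).

  The content is that three successive steps of prime index cannot occur at the top of the series. After
  factoring out the term below these steps, one has a group \<open>H\<close> of order \<open>p q r\<close> in which \<open>R = LC(H)\<close> has prime
  order \<open>r\<close> and lies in a normal subgroup \<open>M\<close> of order \<open>q r\<close>. The quotient \<open>H/R\<close> is not abelian, as otherwise
  the series would already end at the second step. So there is a commutator in \<open>M\<close> outside \<open>R\<close>. It centralizes
  \<open>R\<close>, since the automorphism group of a group of prime order is abelian, and hence \<open>M\<close> is abelian
  (\<open>prime_extension_abelian\<close>). This forces \<open>LCM(H)\<close> to be larger than \<open>R\<close>, a contradiction: if \<open>r = q\<close> it
  contains \<open>M\<close>, and if \<open>r \<noteq> q\<close> it contains the normal subgroup formed by the elements of exponent \<open>q\<close>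
  (\<open>abelian_quotient_by_prime_LC\<close>).

  The tool for showing membership in \<open>LCM\<close> is \<open>prime_exponent_normal_subset_LCM_set\<close>: if the solutions of
  \<open>u ^ q = 1\<close> form a normal subgroup, it lies in \<open>LCM(G)\<close>. It also shows that a non-abelian group of
  order \<open>p q\<close> with \<open>p < q\<close> has its Sylow \<open>q\<close>-subgroup inside \<open>LC(G)\<close>; the reverse inclusion holds because the
  elements outside have order \<open>p\<close> but can be multiplied together to give elements of order \<open>q\<close>. So \<open>LC(G)\<close> has
  order \<open>q\<close>, the quotient of order \<open>p\<close> is abelian, and the class is \<open>2\<close>.\<close>

context group
begin

section \<open>Subgroups of prime order and prime index\<close>

lemma card_subgroup_dvd:
  assumes "subgroup H G" "subgroup K G" "H \<subseteq> K"
  shows "card H dvd card K"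
proof -
  interpret K: group "G\<lparr>carrier := K\<rparr>"
    using assms(2) by (rule subgroup_imp_group)
  have "subgroup H (G\<lparr>carrier := K\<rparr>)"
    using assms subgroup_incl by blast
  from K.lagrange[OF this] show ?thesis
    by (simp add: order_def dvd_def) (metis mult.commute)
qed

text \<open>The index of \<open>R\<close> in \<open>S\<close> divides the prime \<open>q\<close>, so nothing lies strictly between \<open>R\<close> and \<open>M\<close>. This is
  how commutation with \<open>R\<close> and with one element outside \<open>R\<close> spreads to all of \<open>M\<close>.\<close>

lemma subgroup_above_prime_index:
  assumes "finite (carrier G)" "subgroup R G" "subgroup S G" "subgroup M G" "R \<subseteq> S" "S \<subseteq> M"
    and "card M = q * card R" "Factorial_Ring.prime q" "c \<in> S" "c \<notin> R"
  shows "S = M"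
proof -
  have fin: "finite S" "finite M"
    using assms(1,3,4) by (meson finite_subset subgroup.subset)+
  obtain m where m: "card S = card R * m"
    using card_subgroup_dvd[OF assms(2,3,5)] by (elim dvdE)
  have "card R > 0"
    using assms(1,2) subgroup.finite_imp_card_positive by blast
  moreover have "card R * m dvd card R * q"
    using card_subgroup_dvd[OF assms(3,4,6)] m assms(7) by (simp add: mult.commute)
  ultimately have "m dvd q" by simp
  moreover have "m \<noteq> 1"
  proof
    assume "m = 1"
    hence "R = S" using m fin assms(5) by (simp add: card_subset_eq)
    with assms show False by blast
  qed
  ultimately have "m = q" using assms(8) by (auto simp: prime_nat_iff)
  thus ?thesis using m fin assms(6,7) by (simp add: card_subset_eq mult.commute)
qed

lemma ord_dvd_card_subgroup:
  assumes "subgroup L G" "x \<in> L"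
  shows "ord x dvd card L"
proof -
  interpret L: group "G\<lparr>carrier := L\<rparr>"
    using assms(1) by (rule subgroup_imp_group)
  have "x [^] card L = \<one>"
    using L.pow_order_eq_1[of x] assms(2) nat_pow_consistent[of x "card L" L]
    by (simp add: order_def)
  thus ?thesis using assms by (metis pow_eq_id subgroup.mem_carrier)
qed

lemma ord_prime_subgroup:
  assumes "subgroup L G" "Factorial_Ring.prime (card L)" "x \<in> L" "x \<noteq> \<one>"
  shows "ord x = card L"
proof -
  have x: "x \<in> carrier G" using assms by (meson subgroup.mem_carrier)
  have "ord x dvd card L" using assms by (intro ord_dvd_card_subgroup)
  thus ?thesis using assms(2,4) x ord_eq_1 by (auto simp: prime_nat_iff)
qed

lemma prime_subgroup_powers:
  assumes "subgroup L G" "Factorial_Ring.prime (card L)" "x \<in> L" "x \<noteq> \<one>" "y \<in> L"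
  obtains n :: nat where "y = x [^] n"
proof -
  have x: "x \<in> carrier G" using assms by (meson subgroup.mem_carrier)
  have o: "ord x = card L" by (rule ord_prime_subgroup[OF assms(1-4)])
  have "finite L" using assms(2) card_ge_0_finite prime_gt_0_nat by blast
  moreover have "generate G {x} \<subseteq> L" using assms generate_subgroup_incl by blast
  ultimately have "generate G {x} = L"
    using o generate_pow_card[OF x] by (simp add: card_subset_eq)
  moreover have "ord x \<noteq> 0" using o assms(2) by auto
  ultimately show thesis using generate_pow_nat[OF x] assms(5) that by auto
qed

lemma prime_order_comm_group:
  assumes "Factorial_Ring.prime (order G)"
  shows "comm_group G"
proof (rule group_comm_groupI)
  fix x y assume xy: "x \<in> carrier G" "y \<in> carrier G"
  show "x \<otimes> y = y \<otimes> x"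
  proof (cases "x = \<one>")
    case False
    obtain n :: nat where "y = x [^] n"
      using prime_subgroup_powers[OF subgroup_self _ xy(1) False xy(2)] assms order_def by metis
    thus ?thesis using xy by (simp add: nat_pow_Suc2[symmetric])
  qed (use xy in simp)
qed

section \<open>Conjugation and commutators\<close>

lemma commutator_eq_one_iff:
  assumes "x \<in> carrier G" "y \<in> carrier G"
  shows "x \<otimes> y \<otimes> inv x \<otimes> inv y = \<one> \<longleftrightarrow> x \<otimes> y = y \<otimes> x"
proof -
  have "x \<otimes> y \<otimes> inv x \<otimes> inv y = (x \<otimes> y) \<otimes> inv (y \<otimes> x)"
    using assms by (simp add: inv_mult_group m_assoc)
  thus ?thesis using assms by (metis inv_closed inv_equality inv_inv m_closed r_inv)
qed

lemma subgroup_centralizer: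
  assumes "x \<in> carrier G" "subgroup M G"
  shows "subgroup {m \<in> M. m \<otimes> x = x \<otimes> m} G"
proof
  show "{m \<in> M. m \<otimes> x = x \<otimes> m} \<subseteq> carrier G" using assms subgroup.subset by blast
next
  fix u v assume "u \<in> {m \<in> M. m \<otimes> x = x \<otimes> m}" "v \<in> {m \<in> M. m \<otimes> x = x \<otimes> m}"
  thus "u \<otimes> v \<in> {m \<in> M. m \<otimes> x = x \<otimes> m}"
    using assms by (auto intro: subgroup.m_closed) (metis m_assoc subgroup.mem_carrier)
next
  show "\<one> \<in> {m \<in> M. m \<otimes> x = x \<otimes> m}" using assms by (simp add: subgroup.one_closed)
next
  fix u assume "u \<in> {m \<in> M. m \<otimes> x = x \<otimes> m}"
  thus "inv u \<in> {m \<in> M. m \<otimes> x = x \<otimes> m}"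
    using assms
    by (auto intro: subgroup.m_inv_closed)
      (metis inv_closed inv_solve_left inv_solve_right m_assoc m_closed subgroup.mem_carrier)
qed

lemma inv_mult_cancel:
  assumes "g \<in> carrier G" "y \<in> carrier G"
  shows "inv g \<otimes> (g \<otimes> y) = y"
  using assms by (simp flip: m_assoc)

lemma conj_pow:
  assumes "g \<in> carrier G" "x \<in> carrier G"
  shows "(g \<otimes> x \<otimes> inv g) [^] (n::nat) = g \<otimes> x [^] n \<otimes> inv g"
proof (induction n)
  case (Suc n)
  thus ?case using assms by (simp add: m_assoc inv_mult_cancel)
qed (use assms in simp)

lemma ord_conj:
  assumes "g \<in> carrier G" "x \<in> carrier G"
  shows "ord (g \<otimes> x \<otimes> inv g) = ord x"
proof -
  have "g \<otimes> y \<otimes> inv g = \<one> \<longleftrightarrow> y = \<one>" if "y \<in> carrier G" for y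
    using assms that by (metis inv_closed inv_solve_right' l_cancel_one' m_closed one_closed r_inv r_one
        inv_solve_right m_assoc l_inv l_one r_cancel_one)
  thus ?thesis using assms
    by (subst ord_unique) (auto simp: conj_pow pow_eq_id)
qed

lemma prime_subgroup_nontrivial:
  assumes "subgroup L G" "Factorial_Ring.prime (card L)"
  obtains x where "x \<in> L" "x \<noteq> \<one>"
proof -
  have "L \<noteq> {\<one>}" using assms(2) by auto
  thus thesis using that subgroup.one_closed[OF assms(1)] by blast
qed

text \<open>A normal subgroup of prime order is cyclic, so conjugation acts on a generator by an exponent.\<close>

lemma conj_prime_normal_pow:
  assumes "L \<lhd> G" "Factorial_Ring.prime (card L)"
  obtains x where "x \<in> L" "x \<noteq> \<one>"
    "\<And>g. g \<in> carrier G \<Longrightarrow> \<exists>m::nat. g \<otimes> x \<otimes> inv g = x [^] m"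
proof -
  have L: "subgroup L G" using assms(1) normal_imp_subgroup by blast
  obtain x where x: "x \<in> L" "x \<noteq> \<one>"
    using prime_subgroup_nontrivial[OF L assms(2)] by blast
  moreover have "\<exists>m::nat. g \<otimes> x \<otimes> inv g = x [^] m" if "g \<in> carrier G" for g
    using prime_subgroup_powers[OF L assms(2) x normal.inv_op_closed2[OF assms(1) that x(1)]]
    by metis
  ultimately show thesis by (rule that)
qed

text \<open>Exponents multiply, so conjugation by \<open>a\<close> and conjugation by \<open>b\<close> commute as maps on \<open>L\<close>: the
  automorphism group of a group of prime order is abelian, and a commutator acts trivially.\<close>

lemma commutator_centralizes_prime_normal:
  assumes "L \<lhd> G" "Factorial_Ring.prime (card L)"
    and ab: "a \<in> carrier G" "b \<in> carrier G" and "y \<in> L"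
  shows "(a \<otimes> b \<otimes> inv a \<otimes> inv b) \<otimes> y = y \<otimes> (a \<otimes> b \<otimes> inv a \<otimes> inv b)"
proof -
  have L: "subgroup L G" using assms(1) normal_imp_subgroup by blast
  obtain x where x: "x \<in> L" "x \<noteq> \<one>"
    and conj: "\<And>g. g \<in> carrier G \<Longrightarrow> \<exists>m::nat. g \<otimes> x \<otimes> inv g = x [^] m"
    using conj_prime_normal_pow[OF assms(1,2)] by metis
  have xG: "x \<in> carrier G" using x L by (meson subgroup.mem_carrier)
  obtain m n :: nat where m: "a \<otimes> x \<otimes> inv a = x [^] m" and n: "b \<otimes> x \<otimes> inv b = x [^] n"
    using conj ab by metis
  have "(a \<otimes> b) \<otimes> x \<otimes> inv (a \<otimes> b) = a \<otimes> (b \<otimes> x \<otimes> inv b) \<otimes> inv a"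
    using ab xG by (simp add: inv_mult_group m_assoc)
  also have "\<dots> = x [^] (m * n)"
    unfolding n conj_pow[OF ab(1) xG, symmetric] m using xG by (simp add: nat_pow_pow)
  finally have 1: "(a \<otimes> b) \<otimes> x \<otimes> inv (a \<otimes> b) = x [^] (m * n)" .
  have "(b \<otimes> a) \<otimes> x \<otimes> inv (b \<otimes> a) = b \<otimes> (a \<otimes> x \<otimes> inv a) \<otimes> inv b"
    using ab xG by (simp add: inv_mult_group m_assoc)
  also have "\<dots> = x [^] (m * n)"
    unfolding m conj_pow[OF ab(2) xG, symmetric] n using xG by (simp add: nat_pow_pow mult.commute)
  finally have 2: "(b \<otimes> a) \<otimes> x \<otimes> inv (b \<otimes> a) = x [^] (m * n)" .
  let ?c = "a \<otimes> b \<otimes> inv a \<otimes> inv b"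
  have c: "?c = (a \<otimes> b) \<otimes> inv (b \<otimes> a)" "?c \<in> carrier G"
    using ab by (simp_all add: inv_mult_group m_assoc)
  \<comment> \<open>Both \<open>a b\<close> and \<open>b a\<close> conjugate \<open>x\<close> to the generator \<open>x ^ (m n)\<close>, which therefore commutes with \<open>c\<close>.\<close>
  have "?c \<otimes> x [^] (m * n) = (a \<otimes> b) \<otimes> x \<otimes> inv (b \<otimes> a)"
    unfolding c(1) 2[symmetric] using ab xG by (simp add: m_assoc inv_mult_cancel inv_mult_group)
  also have "\<dots> = x [^] (m * n) \<otimes> ?c"
    unfolding c(1) 1[symmetric] using ab xG by (simp add: m_assoc inv_mult_cancel inv_mult_group)
  finally have comm: "?c \<otimes> x [^] (m * n) = x [^] (m * n) \<otimes> ?c" .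
  have xmn: "x [^] (m * n) \<in> L" using 1 2 x assms(1) ab by (metis m_closed normal.inv_op_closed2)
  have "x [^] (m * n) \<noteq> \<one>"
    using ord_conj[of "a \<otimes> b" x] 1 ab xG x by (metis m_closed ord_eq_1 ord_id)
  then obtain k :: nat where k: "y = (x [^] (m * n)) [^] k"
    using prime_subgroup_powers[OF L assms(2) xmn _ assms(5)] by metis
  show ?thesis unfolding k using comm c(2) xG
    by (metis nat_pow_closed group_commutes_pow)
qed

text \<open>Conjugation by \<open>g\<close> raises the generator \<open>x\<close> of \<open>L\<close> to some power \<open>m\<close>. Since \<open>g\<close> to the power
  \<open>p\<^sup>2\<close> is trivial, \<open>m\<close> to the power \<open>p\<^sup>2\<close> is \<open>1\<close> modulo \<open>p\<close>, while by Fermat it is \<open>m\<close>; so \<open>L\<close> is central.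
  The centralizer of an element outside \<open>L\<close> then contains \<open>L\<close> strictly and has to be everything.\<close>

lemma card_prime_square_comm:
  assumes "L \<lhd> G" "card L = p" "order G = p * p" "Factorial_Ring.prime p"
  shows "comm_group G"
proof -
  have L: "subgroup L G" using assms(1) normal_imp_subgroup by blast
  have fin: "finite (carrier G)"
    using assms(3,4) order_gt_0_iff_finite by (simp add: prime_gt_0_nat)
  have pL: "Factorial_Ring.prime (card L)" using assms by simp
  obtain x where x: "x \<in> L" "x \<noteq> \<one>"
    and conj: "\<And>g. g \<in> carrier G \<Longrightarrow> \<exists>m::nat. g \<otimes> x \<otimes> inv g = x [^] m"
    using conj_prime_normal_pow[OF assms(1) pL] by metis
  have xG: "x \<in> carrier G" using x L by (meson subgroup.mem_carrier)
  have ox: "ord x = p" using ord_prime_subgroup[OF L pL x] assms(2) by simp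
  have xcomm: "g \<otimes> x = x \<otimes> g" if g: "g \<in> carrier G" for g
  proof -
    obtain m :: nat where m: "g \<otimes> x \<otimes> inv g = x [^] m" using conj[OF g] by blast
    have it: "g [^] i \<otimes> x \<otimes> inv (g [^] i) = x [^] (m ^ i)" for i :: nat
    proof (induction i)
      case (Suc i)
      have "g [^] Suc i \<otimes> x \<otimes> inv (g [^] Suc i) = g [^] i \<otimes> (g \<otimes> x \<otimes> inv g) \<otimes> inv (g [^] i)"
        using g xG by (simp add: m_assoc inv_mult_group)
      also have "\<dots> = (x [^] (m ^ i)) [^] m"
        unfolding m using g xG Suc by (simp add: conj_pow[symmetric])
      finally show ?case using xG by (simp add: nat_pow_pow mult.commute)
    qed (use xG in simp)
    have "g [^] (p * p) = \<one>" using pow_order_eq_1[OF g] assms(3) by simp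
    hence "x [^] (m ^ (p * p)) = x" using it[of "p * p"] xG by simp
    hence "x [^] (int 1) = x [^] (int (m ^ (p * p)))" using xG by (simp add: int_pow_int del: of_nat_power)
    hence c1: "[m ^ (p * p) = 1] (mod p)"
      using int_pow_eq[OF xG, of "int 1" "int (m ^ (p * p))"] ox
      by (metis cong_iff_dvd_diff cong_int_iff)
    have fermat: "[n ^ p = n] (mod p)" for n :: nat
    proof (cases "p dvd n")
      case True
      thus ?thesis using assms(4)
        by (metis cong_0_iff cong_sym cong_trans dvd_power dvd_trans prime_gt_0_nat)
    next
      case False
      have "[n ^ (p - 1) * n = 1 * n] (mod p)"
        using fermat_theorem[OF assms(4) False] by (rule cong_scalar_right)
      moreover have "n ^ (p - 1) * n = n ^ p"
        using assms(4) by (intro power_minus_mult prime_gt_0_nat)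
      ultimately show ?thesis by simp
    qed
    have "[m ^ (p * p) = m] (mod p)"
      using fermat[of "m ^ p"] fermat[of m] cong_trans by (simp add: power_mult) blast
    hence "[1 = m] (mod p)" using c1 cong_sym cong_trans by blast
    hence "x [^] (int m) = x [^] (int 1)"
      using int_pow_eq[OF xG, of "int m" "int 1"] ox by (metis cong_iff_dvd_diff cong_int_iff)
    hence "x [^] m = x" using xG by (simp add: int_pow_int)
    hence "g \<otimes> x \<otimes> inv g = x" using m by simp
    thus ?thesis using g xG by (metis inv_solve_right m_closed)
  qed
  show ?thesis
  proof (rule group_comm_groupI)
    fix a b assume ab: "a \<in> carrier G" "b \<in> carrier G"
    show "a \<otimes> b = b \<otimes> a"
    proof (cases "a \<in> L")
      case True
      obtain n :: nat where "a = x [^] n" using prime_subgroup_powers[OF L pL x True] by blast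
      thus ?thesis using xcomm[OF ab(2)] ab xG group_commutes_pow by simp
    next
      case False
      let ?C = "{m \<in> carrier G. m \<otimes> a = a \<otimes> m}"
      have "L \<subseteq> ?C"
      proof
        fix y assume y: "y \<in> L"
        obtain n :: nat where "y = x [^] n" using prime_subgroup_powers[OF L pL x y] by blast
        thus "y \<in> ?C" using xcomm[OF ab(1)] ab xG group_commutes_pow by simp
      qed
      hence C: "?C = carrier G"
        using subgroup_above_prime_index[OF fin L subgroup_centralizer[OF ab(1) subgroup_self]
            subgroup_self, of p a] assms False ab by (auto simp: order_def)
      have "b \<in> ?C" unfolding C by (rule ab(2))
      thus ?thesis by simp
    qed
  qed
qed

section \<open>Quotients by normal subgroups\<close>

lemma group_hom_Mod:
  assumes "N \<lhd> G"
  shows "group_hom G (G Mod N) (\<lambda>x. N #> x)"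
  using assms by (simp add: group_hom_def group_hom_axioms_def normal.r_coset_hom_Mod
      normal.factorgroup_is_group)

lemma coset_eq_iff_mem:
  assumes "N \<lhd> G" "x \<in> carrier G"
  shows "N #> x = N \<longleftrightarrow> x \<in> N"
  using assms coset_join1 coset_join2 normal_imp_subgroup by metis

lemma card_coset_image:
  assumes "N \<lhd> G" "subgroup S G" "N \<subseteq> S"
  shows "card ((\<lambda>x. N #> x) ` S) * card N = card S"
proof -
  interpret S: group "G\<lparr>carrier := S\<rparr>"
    using assms(2) by (rule subgroup_imp_group)
  have "subgroup N (G\<lparr>carrier := S\<rparr>)"
    using assms subgroup_incl normal_imp_subgroup by blast
  from S.lagrange[OF this] show ?thesis
    by (simp add: order_def RCOSETS_def r_coset_def UNION_singleton_eq_range)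
qed

lemma order_Mod:
  assumes "N \<lhd> G"
  shows "order (G Mod N) * card N = order G"
  using lagrange[OF normal_imp_subgroup[OF assms]] by (simp add: order_def FactGroup_def)

lemma comm_group_Mod_iff:
  assumes "N \<lhd> G"
  shows "comm_group (G Mod N) \<longleftrightarrow>
    (\<forall>a\<in>carrier G. \<forall>b\<in>carrier G. a \<otimes> b \<otimes> inv a \<otimes> inv b \<in> N)"
proof -
  interpret h: group_hom G "G Mod N" "\<lambda>x. N #> x" by (rule group_hom_Mod[OF assms])
  have eq: "(N #> a) \<otimes>\<^bsub>G Mod N\<^esub> (N #> b) = (N #> b) \<otimes>\<^bsub>G Mod N\<^esub> (N #> a)
      \<longleftrightarrow> a \<otimes> b \<otimes> inv a \<otimes> inv b \<in> N" if "a \<in> carrier G" "b \<in> carrier G" for a b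
  proof -
    have "a \<otimes> b \<otimes> inv a \<otimes> inv b \<in> N \<longleftrightarrow> N #> (a \<otimes> b \<otimes> inv a \<otimes> inv b) = \<one>\<^bsub>G Mod N\<^esub>"
      using that coset_eq_iff_mem[OF assms, of "a \<otimes> b \<otimes> inv a \<otimes> inv b"] by simp
    also have "N #> (a \<otimes> b \<otimes> inv a \<otimes> inv b) = (N #> a) \<otimes>\<^bsub>G Mod N\<^esub> (N #> b)
        \<otimes>\<^bsub>G Mod N\<^esub> inv\<^bsub>G Mod N\<^esub> (N #> a) \<otimes>\<^bsub>G Mod N\<^esub> inv\<^bsub>G Mod N\<^esub> (N #> b)"
      using that by (simp only: h.hom_mult h.hom_inv m_closed inv_closed)
    finally show ?thesis using h.H.commutator_eq_one_iff that h.hom_closed by metis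
  qed
  show ?thesis
  proof
    assume "comm_group (G Mod N)"
    then interpret Q: comm_group "G Mod N" .
    show "\<forall>a\<in>carrier G. \<forall>b\<in>carrier G. a \<otimes> b \<otimes> inv a \<otimes> inv b \<in> N"
      using eq Q.m_comm h.hom_closed by blast
  next
    assume *: "\<forall>a\<in>carrier G. \<forall>b\<in>carrier G. a \<otimes> b \<otimes> inv a \<otimes> inv b \<in> N"
    show "comm_group (G Mod N)"
    proof (rule h.H.group_comm_groupI)
      fix u v assume "u \<in> carrier (G Mod N)" "v \<in> carrier (G Mod N)"
      then obtain a b where "a \<in> carrier G" "b \<in> carrier G" "u = N #> a" "v = N #> b"
        by (auto simp: carrier_FactGroup)
      thus "u \<otimes>\<^bsub>G Mod N\<^esub> v = v \<otimes>\<^bsub>G Mod N\<^esub> u" using eq * by metis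
    qed
  qed
qed

lemma pow_mem_normal_iff:
  assumes "N \<lhd> G" "w \<in> carrier G"
  shows "w [^] (n::nat) \<in> N \<longleftrightarrow> group.ord (G Mod N) (N #> w) dvd n"
proof -
  interpret h: group_hom G "G Mod N" "\<lambda>x. N #> x" by (rule group_hom_Mod[OF assms(1)])
  have "h.H.ord (N #> w) dvd n \<longleftrightarrow> (N #> w) [^]\<^bsub>G Mod N\<^esub> n = \<one>\<^bsub>G Mod N\<^esub>"
    using h.H.pow_eq_id h.hom_closed assms(2) by blast
  also have "(N #> w) [^]\<^bsub>G Mod N\<^esub> n = N #> (w [^] n)"
    using h.hom_nat_pow[OF assms(2)] by simp
  finally show ?thesis using coset_eq_iff_mem[OF assms(1)] assms(2) by auto
qed

text \<open>The coset of \<open>w\<close> is a nontrivial element of a group of prime order \<open>p\<close>, hence has order \<open>p\<close>.\<close>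

lemma pow_mem_normal_prime_index:
  assumes "K \<lhd> G" "order (G Mod K) = p" "Factorial_Ring.prime p" "w \<in> carrier G" "w \<notin> K"
  shows "w [^] (n::nat) \<in> K \<longleftrightarrow> p dvd n"
proof -
  interpret h: group_hom G "G Mod K" "\<lambda>x. K #> x" by (rule group_hom_Mod[OF assms(1)])
  have w: "K #> w \<in> carrier (G Mod K)" "K #> w \<noteq> \<one>\<^bsub>G Mod K\<^esub>"
    using assms(4,5) coset_eq_iff_mem[OF assms(1,4)] h.hom_closed by auto
  have "h.H.ord (K #> w) = p"
    using h.H.ord_prime_subgroup[OF h.H.subgroup_self _ w] assms(2,3) by (simp add: order_def)
  thus ?thesis using pow_mem_normal_iff[OF assms(1,4)] by simp
qed

section \<open>The set LCM and the subgroup LC\<close>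

lemma LCM_set_subset: "LCM_set G \<subseteq> carrier G"
  by (auto simp: LCM_set_def)

lemma LCM_set_subset_LC: "LCM_set G \<subseteq> LC G"
  by (auto simp: LC_def intro: generate.incl)

lemma ord_mult_dvd_lcm:
  assumes "x \<in> carrier G" "y \<in> carrier G" "x \<otimes> y = y \<otimes> x"
  shows "ord (x \<otimes> y) dvd lcm (ord x) (ord y)"
proof -
  have "x [^] lcm (ord x) (ord y) = \<one>" "y [^] lcm (ord x) (ord y) = \<one>"
    using assms by (simp_all add: pow_eq_id)
  hence "(x \<otimes> y) [^] lcm (ord x) (ord y) = \<one>"
    using assms by (simp add: pow_mult_distrib)
  thus ?thesis using assms pow_eq_id by blast
qed

text \<open>Conjugation by \<open>g\<close> preserves orders and turns the condition on \<open>x\<close> at \<open>y\<close> into the condition on the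
  conjugate of \<open>x\<close> at the conjugate of \<open>y\<close>; so the generating set of \<open>LC(G)\<close> is closed under conjugation.\<close>

lemma LC_normal: "LC G \<lhd> G"
  unfolding LC_def
proof (rule normal_generateI[OF LCM_set_subset])
  fix x g assume x: "x \<in> LCM_set G" and g: "g \<in> carrier G"
  have xG: "x \<in> carrier G" using x LCM_set_subset by blast
  show "g \<otimes> x \<otimes> inv g \<in> LCM_set G"
    unfolding LCM_set_def mem_Collect_eq
  proof (intro conjI ballI allI)
    show "g \<otimes> x \<otimes> inv g \<in> carrier G" using g xG by simp
    fix y and n :: int assume y: "y \<in> carrier G"
    have pow: "(g \<otimes> x \<otimes> inv g) [^] n = g \<otimes> x [^] n \<otimes> inv g"
    proof (cases n rule: int_cases2)
      case (nonneg k) thus ?thesis using g xG by (simp add: int_pow_int conj_pow)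
    next
      case (nonpos k)
      thus ?thesis using g xG
        by (simp add: int_pow_neg int_pow_int conj_pow) (simp add: inv_mult_group m_assoc)
    qed
    let ?z = "inv g \<otimes> y \<otimes> inv (inv g)"
    have z: "?z \<in> carrier G" using g y by simp
    have "g \<otimes> x [^] n \<otimes> inv g \<otimes> y = g \<otimes> (x [^] n \<otimes> ?z) \<otimes> inv g"
      using g y xG by (simp add: m_assoc)
    hence "ord ((g \<otimes> x \<otimes> inv g) [^] n \<otimes> y) = ord (x [^] n \<otimes> ?z)"
      using pow ord_conj[OF g, of "x [^] n \<otimes> ?z"] z xG by simp
    moreover have "ord ((g \<otimes> x \<otimes> inv g) [^] n) = ord (x [^] n)"
      using pow ord_conj[OF g] xG by simp
    moreover have "ord ?z = ord y" using ord_conj[OF inv_closed[OF g] y] .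
    moreover have "ord (x [^] n \<otimes> ?z) dvd lcm (ord (x [^] n)) (ord ?z)"
      using x z by (auto simp: LCM_set_def)
    ultimately show "ord ((g \<otimes> x \<otimes> inv g) [^] n \<otimes> y) dvd
        lcm (ord ((g \<otimes> x \<otimes> inv g) [^] n)) (ord y)" by simp
  qed
qed

lemma LC_comm_group:
  assumes "comm_group G"
  shows "LC G = carrier G"
proof -
  interpret comm_group G by fact
  have "carrier G \<subseteq> LCM_set G"
    by (auto simp: LCM_set_def intro!: ord_mult_dvd_lcm m_comm)
  thus ?thesis using LCM_set_subset_LC LC_normal normal_imp_subgroup subgroup.subset by blast
qed

text \<open>For a nontrivial \<open>z \<in> Q\<close> the elements \<open>z y\<close> and \<open>y\<close> have the same coset of \<open>Q\<close>, so their powers enter \<open>Q\<close> at the same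
  exponents \<open>n\<close>, and then \<open>n q\<close> annihilates \<open>z y\<close>. If \<open>q\<close> does not divide \<open>d = o(y)\<close>, the exponent \<open>n = d\<close> gives
  the bound \<open>d q = lcm q d\<close>. If it does, \<open>y\<close> to the power \<open>n = d / q\<close> is killed by \<open>q\<close>, so it already lies in
  \<open>Q\<close>, and the bound is \<open>d\<close> itself. The second case is where \<open>Q\<close> has to contain all elements of
  exponent \<open>q\<close>. This lemma supplies members of \<open>LCM(G)\<close> in both directions of the theorem.\<close>

lemma prime_exponent_normal_subset_LCM_set:
  fixes q :: nat
  assumes "Q \<lhd> G" "Factorial_Ring.prime q" "Q = {u \<in> carrier G. u [^] q = \<one>}"
  shows "Q \<subseteq> LCM_set G"
proof
  fix x assume x: "x \<in> Q"
  interpret h: group_hom G "G Mod Q" "\<lambda>x. Q #> x" by (rule group_hom_Mod[OF assms(1)])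
  have Q: "subgroup Q G" using assms(1) normal_imp_subgroup by blast
  have xG: "x \<in> carrier G" using x assms by blast
  have "ord (z \<otimes> y) dvd lcm (ord z) (ord y)" if z: "z \<in> Q" and y: "y \<in> carrier G" for z y
  proof (cases "z = \<one>")
    case False
    have zG: "z \<in> carrier G" using z assms by blast
    define d where "d = ord y"
    have "ord z dvd q" using z assms(3) pow_eq_id by blast
    hence oz: "ord z = q" using False assms(2) zG ord_eq_1 by (auto simp: prime_nat_iff)
    have zyG: "z \<otimes> y \<in> carrier G" using zG y by simp
    have "Q #> z = \<one>\<^bsub>G Mod Q\<^esub>" using coset_eq_iff_mem[OF assms(1) zG] z by simp
    hence "Q #> (z \<otimes> y) = \<one>\<^bsub>G Mod Q\<^esub> \<otimes>\<^bsub>G Mod Q\<^esub> (Q #> y)"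
      using h.hom_mult[OF zG y] by (simp only:)
    hence "Q #> (z \<otimes> y) = Q #> y" using h.H.l_one[OF h.hom_closed[OF y]] by (simp only:)
    hence "Q #> ((z \<otimes> y) [^] n) = Q #> (y [^] n)" for n :: nat
      using h.hom_nat_pow zyG y by metis
    hence pow_Q: "(z \<otimes> y) [^] n \<in> Q \<longleftrightarrow> y [^] n \<in> Q" for n :: nat
      using coset_eq_iff_mem[OF assms(1)] zyG y by (metis nat_pow_closed)
    have Q_dvd: "ord (z \<otimes> y) dvd n * q" if "y [^] n \<in> Q" for n :: nat
    proof -
      have "((z \<otimes> y) [^] n) [^] q = \<one>" using that pow_Q assms(3) by blast
      thus ?thesis using zyG pow_eq_id by (simp add: nat_pow_pow)
    qed
    show ?thesis
    proof (cases "q dvd d")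
      case True
      then obtain d' where d': "d = d' * q" by (metis dvdE mult.commute)
      have "(y [^] d') [^] q = y [^] ord y"
        using y d'[symmetric] by (simp only: nat_pow_pow d_def)
      hence "(y [^] d') [^] q = \<one>" using y by simp
      hence "y [^] d' \<in> Q" using assms(3) y by auto
      from Q_dvd[OF this] show ?thesis using d' d_def by (metis dvd_lcm2 dvd_trans)
    next
      case False
      have "y [^] d \<in> Q" using y d_def Q by (simp add: subgroup.one_closed)
      from Q_dvd[OF this] have "ord (z \<otimes> y) dvd d * q" .
      moreover have "coprime q d" using False assms(2) prime_imp_coprime by blast
      ultimately show ?thesis
        unfolding oz d_def[symmetric] by (simp add: lcm_coprime mult.commute)
    qed
  qed (use y in simp)
  thus "x \<in> LCM_set G"
    using x xG subgroup_int_pow_closed[OF Q] by (simp add: LCM_set_def)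
qed


section \<open>Two steps of prime index above LC of prime order\<close>

lemma comm_group_if_ord_eq_order:
  assumes "finite (carrier G)" "w \<in> carrier G" "ord w = order G"
  shows "comm_group G"
proof (rule group_comm_groupI)
  have "generate G {w} \<subseteq> carrier G" using assms(2) by (simp add: generate_incl)
  hence "generate G {w} = carrier G"
    using assms generate_pow_card[of w] by (simp add: card_subset_eq order_def)
  hence powers: "\<exists>n::nat. x = w [^] n" if "x \<in> carrier G" for x
    using that generate_pow_nat[OF assms(2)] assms order_gt_0_iff_finite by auto
  fix x y assume "x \<in> carrier G" "y \<in> carrier G"
  then obtain m n :: nat where "x = w [^] m" "y = w [^] n" using powers by metis
  thus "x \<otimes> y = y \<otimes> x" using assms(2) by (simp add: nat_pow_mult add.commute)
qed

lemma image_Mod_normal: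
  assumes "N \<lhd> G" "M \<lhd> G"
  shows "(\<lambda>x. N #> x) ` M \<lhd> G Mod N"
  using normal.surj_hom_normal_subgroup[OF assms(2) group_hom_Mod[OF assms(1)]]
  by (simp add: carrier_FactGroup)

text \<open>A commutator \<open>c\<close> outside \<open>R\<close> centralizes \<open>R\<close>, and \<open>R\<close> together with \<open>c\<close> generates \<open>M\<close> because the index
  of \<open>R\<close> in \<open>M\<close> is prime. So \<open>M\<close> is generated by pairwise commuting elements.\<close>

lemma prime_extension_abelian:
  assumes fin: "finite (carrier G)" and R: "R \<lhd> G" and r: "Factorial_Ring.prime (card R)"
    and M: "M \<lhd> G" and "R \<subseteq> M" and card_M: "card M = q * card R"
    and q: "Factorial_Ring.prime q"
    and ab: "a \<in> carrier G" "b \<in> carrier G"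
    and c: "a \<otimes> b \<otimes> inv a \<otimes> inv b \<in> M" "a \<otimes> b \<otimes> inv a \<otimes> inv b \<notin> R"
    and uv: "u \<in> M" "v \<in> M"
  shows "u \<otimes> v = v \<otimes> u"
proof -
  define c where "c = a \<otimes> b \<otimes> inv a \<otimes> inv b"
  have sR: "subgroup R G" and sM: "subgroup M G"
    using R M normal_imp_subgroup by blast+
  have sub: "M \<subseteq> carrier G" using sM subgroup.subset by blast
  have cM: "c \<in> M" "c \<notin> R" using c by (simp_all add: c_def)
  have cR: "c \<otimes> y = y \<otimes> c" if "y \<in> R" for y
    using commutator_centralizes_prime_normal[OF R r ab that] by (simp add: c_def)
  have cent: "m \<otimes> x = x \<otimes> m"
    if x: "x \<in> M" "c \<otimes> x = x \<otimes> c" "\<And>y. y \<in> R \<Longrightarrow> y \<otimes> x = x \<otimes> y" and m: "m \<in> M" for x m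
  proof -
    have "{m \<in> M. m \<otimes> x = x \<otimes> m} = M"
    proof (rule subgroup_above_prime_index[OF fin sR _ sM _ _ card_M q])
      show "subgroup {m \<in> M. m \<otimes> x = x \<otimes> m} G"
        using subgroup_centralizer sM x(1) sub by blast
    qed (use x cM \<open>R \<subseteq> M\<close> in auto)
    thus ?thesis using m by blast
  qed
  have RR: "x \<otimes> y = y \<otimes> x" if "x \<in> R" "y \<in> R" for x y
  proof -
    interpret R: comm_group "G\<lparr>carrier := R\<rparr>"
      using group.prime_order_comm_group[OF subgroup_imp_group[OF sR]] r by (simp add: order_def)
    show ?thesis using R.m_comm that by simp
  qed
  have Mc: "m \<otimes> c = c \<otimes> m" if "m \<in> M" for m
    by (rule cent[OF cM(1) refl _ that]) (simp add: cR)
  have MR: "m \<otimes> x = x \<otimes> m" if "m \<in> M" "x \<in> R" for m x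
    using cent[of x m] cR RR that \<open>R \<subseteq> M\<close> by blast
  show ?thesis
    by (rule cent[OF uv(2) _ _ uv(1)]) (simp_all add: Mc MR uv)
qed

text \<open>The obstruction to a third step of prime index. If \<open>G/R\<close> is non-abelian, where \<open>R = LC(G)\<close>, then some
  commutator \<open>c \<in> M\<close> lies outside \<open>R\<close>, so \<open>M\<close> is abelian; moreover \<open>p \<noteq> q\<close>, as \<open>G/R\<close> would otherwise have order
  \<open>p\<^sup>2\<close>. In both cases below \<open>LCM(G)\<close> acquires an element outside \<open>LC(G)\<close>. If \<open>R\<close> has order \<open>q\<close>, all of \<open>M\<close>
  lies in \<open>LCM(G)\<close>: elements outside \<open>M\<close> have order \<open>p\<close> or \<open>p q\<close>, since an element of order \<open>p q\<^sup>2\<close> would make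
  \<open>G\<close> cyclic. Otherwise the elements of exponent \<open>q\<close> form a normal subgroup contained in \<open>LCM(G)\<close> and not in
  \<open>R\<close>.\<close>

lemma abelian_quotient_by_prime_LC:
  assumes fin: "finite (carrier G)" and r: "Factorial_Ring.prime (card (LC G))"
    and M: "M \<lhd> G" and RM: "LC G \<subseteq> M" and card_M: "card M = q * card (LC G)"
    and ord_G: "order G = p * card M"
    and q: "Factorial_Ring.prime q" and p: "Factorial_Ring.prime p"
  shows "comm_group (G Mod LC G)"
proof (rule ccontr)
  assume nc: "\<not> comm_group (G Mod LC G)"
  define R where "R = LC G"
  have R: "R \<lhd> G" unfolding R_def by (rule LC_normal)
  have sR: "subgroup R G" and sM: "subgroup M G"
    using R M normal_imp_subgroup by blast+
  have sub: "M \<subseteq> carrier G" using sM subgroup.subset by blast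
  have pos: "card R > 0" "card M > 0"
    using r q card_M by (simp_all add: R_def prime_gt_0_nat)
  have ord_M: "order (G Mod M) = p" using order_Mod[OF M] ord_G pos by simp
  obtain a b where ab: "a \<in> carrier G" "b \<in> carrier G" "a \<otimes> b \<otimes> inv a \<otimes> inv b \<notin> R"
    using nc comm_group_Mod_iff[OF R] by (auto simp: R_def)
  define c where "c = a \<otimes> b \<otimes> inv a \<otimes> inv b"
  interpret hM: group_hom G "G Mod M" "\<lambda>x. M #> x" by (rule group_hom_Mod[OF M])
  interpret hR: group_hom G "G Mod R" "\<lambda>x. R #> x" by (rule group_hom_Mod[OF R])
  have "comm_group (G Mod M)" using hM.H.prime_order_comm_group ord_M p by simp
  hence c: "c \<in> M" "c \<notin> R" using ab comm_group_Mod_iff[OF M] by (auto simp: c_def)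
  have cG: "c \<in> carrier G" using c sub by blast
  have MM: "u \<otimes> v = v \<otimes> u" if "u \<in> M" "v \<in> M" for u v
    using prime_extension_abelian[OF fin R r[folded R_def] M RM[folded R_def]
        card_M[folded R_def] q ab(1,2) c[unfolded c_def] that] .
  have card_img: "card ((\<lambda>x. R #> x) ` M) = q"
    using card_coset_image[OF R sM] RM card_M pos by (simp add: R_def)
  have "p \<noteq> q"
  proof
    assume "p = q"
    have "order (G Mod R) = p * q"
      using order_Mod[OF R] ord_G card_M pos by (simp add: R_def)
    hence "comm_group (G Mod R)"
      using hR.H.card_prime_square_comm[OF image_Mod_normal[OF R M]] card_img \<open>p = q\<close> q by simp
    thus False using nc by (simp add: R_def)
  qed
  hence pq: "coprime p q" using p q primes_coprime by blast
  show False
  proof (cases "card R = q")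
    case True
    have "M \<subseteq> LCM_set G"
    proof
      fix x assume x: "x \<in> M"
      have "ord (z \<otimes> y) dvd lcm (ord z) (ord y)" if z: "z \<in> M" and y: "y \<in> carrier G" for z y
      proof -
        consider "y \<in> M" | "z = \<one>" | "y \<notin> M" "z \<noteq> \<one>" by blast
        thus ?thesis
        proof cases
          case 1
          thus ?thesis using ord_mult_dvd_lcm z y MM sub by blast
        next
          case 3
          have zG: "z \<in> carrier G" using z sub by blast
          have w: "z \<otimes> y \<in> carrier G" "z \<otimes> y \<notin> M"
            using zG y z 3 sM by (auto simp: inv_solve_left)
              (metis inv_mult_cancel subgroup.m_closed subgroup.m_inv_closed)
          have p_ord: "p dvd ord v" if "v \<in> carrier G" "v \<notin> M" for v
            using pow_mem_normal_prime_index[OF M ord_M p that, of "ord v"] that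
              subgroup.one_closed[OF sM] by simp
          \<comment> \<open>Both \<open>p\<close> and \<open>q\<close> divide the lcm, so it suffices that the order of \<open>z y\<close> divides \<open>p q\<close>.\<close>
          have "ord z dvd q ^ 2"
            using ord_dvd_card_subgroup[OF sM z] card_M True by (simp add: R_def power2_eq_square)
          moreover have "ord z \<noteq> 1" using 3 zG ord_eq_1 by blast
          ultimately have "q dvd ord z"
            using q by (metis dvd_power_same divides_primepow_nat power_0 dvd_power neq0_conv)
          hence lcm: "p * q dvd lcm (ord z) (ord y)"
            using p_ord[OF y 3(1)] pq by (meson divides_mult dvd_lcm1 dvd_lcm2 dvd_trans)
          obtain e where e: "ord (z \<otimes> y) = p * e" using p_ord[OF w] by (elim dvdE)
          have "p * e dvd p * q ^ 2"
            using ord_dvd_group_order[OF w(1)] e ord_G card_M True by (simp add: R_def power2_eq_square)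
          hence "e dvd q ^ 2" using p by (simp add: prime_gt_0_nat)
          then obtain i where i: "i \<le> 2" "e = q ^ i" using q divides_primepow_nat by blast
          have "i \<noteq> 2"
          proof
            assume "i = 2"
            hence "ord (z \<otimes> y) = order G"
              using e i ord_G card_M True by (simp add: R_def power2_eq_square)
            hence "comm_group G" using comm_group_if_ord_eq_order[OF fin w(1)] by simp
            hence "comm_group (G Mod R)" using comm_group.abelian_FactGroup sR by blast
            thus False using nc by (simp add: R_def)
          qed
          hence "i \<le> 1" using i by simp
          hence "e dvd q" using i le_imp_power_dvd[of i 1 q] by simp
          thus ?thesis using e lcm by (metis dvd_trans dvd_refl mult_dvd_mono)
        qed (use y in simp)
      qed
      thus "x \<in> LCM_set G"
        using x sub subgroup_int_pow_closed[OF sM] by (auto simp: LCM_set_def)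
    qed
    hence "M = R" using LCM_set_subset_LC RM by (auto simp: R_def)
    thus False using c by blast
  next
    case False
    hence qr: "coprime q (card R)" using q r primes_coprime by (metis R_def)
    define Q where "Q = {u \<in> carrier G. u [^] q = \<one>}"
    have QM: "Q \<subseteq> M"
    proof
      fix u assume u: "u \<in> Q"
      have "\<not> p dvd q" using p q \<open>p \<noteq> q\<close> primes_dvd_imp_eq by blast
      thus "u \<in> M"
        using u pow_mem_normal_prime_index[OF M ord_M p, of u q] subgroup.one_closed[OF sM]
        by (auto simp: Q_def)
    qed
    have "Q \<lhd> G"
    proof (rule normal_invI)
      show "subgroup Q G"
      proof
        fix u v assume uv: "u \<in> Q" "v \<in> Q"
        hence "u \<otimes> v = v \<otimes> u" using MM QM by blast
        thus "u \<otimes> v \<in> Q" using uv by (simp add: Q_def pow_mult_distrib)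
      qed (auto simp: Q_def nat_pow_inv)
    next
      fix g u assume "g \<in> carrier G" "u \<in> Q"
      thus "g \<otimes> u \<otimes> inv g \<in> Q" by (simp add: Q_def conj_pow)
    qed
    hence QR: "Q \<subseteq> R"
      using prime_exponent_normal_subset_LCM_set[OF _ q Q_def] LCM_set_subset_LC R_def by blast
    \<comment> \<open>The \<open>q\<close>-part of \<open>c\<close> lies in \<open>Q \<subseteq> R\<close>, so the order of \<open>c\<close> modulo \<open>R\<close> divides both \<open>q\<close> and \<open>card R\<close>.\<close>
    have "ord c dvd card R * q"
      using ord_dvd_card_subgroup[OF sM c(1)] card_M by (simp add: R_def mult.commute)
    hence "c [^] card R \<in> Q" using cG by (simp add: Q_def nat_pow_pow pow_eq_id)
    hence "hR.H.ord (R #> c) dvd card R" using QR pow_mem_normal_iff[OF R cG] by blast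
    moreover have "hR.H.ord (R #> c) dvd q"
      using hR.H.ord_dvd_card_subgroup[OF hR.subgroup_img_is_subgroup[OF sM], of "R #> c"]
        card_img c by simp
    ultimately have "hR.H.ord (R #> c) = 1" using qr by (metis coprime_common_divisor_nat)
    hence "c \<in> R" using pow_mem_normal_iff[OF R cG, of 1] cG by simp
    thus False using c by simp
  qed
qed

section \<open>The LC-series\<close>

lemma preimage_Mod_normal:
  assumes "N \<lhd> G" "T \<lhd> G Mod N"
  shows "{x \<in> carrier G. N #> x \<in> T} \<lhd> G"
proof -
  interpret h: group_hom G "G Mod N" "\<lambda>x. N #> x" by (rule group_hom_Mod[OF assms(1)])
  have T: "subgroup T (G Mod N)" using assms(2) normal_imp_subgroup by blast
  show ?thesis
  proof (rule normal_invI)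
    show "subgroup {x \<in> carrier G. N #> x \<in> T} G"
    proof
      show "\<one> \<in> {x \<in> carrier G. N #> x \<in> T}"
        using subgroup.one_closed[OF T] h.hom_one by (simp only: mem_Collect_eq one_closed simp_thms)
    next
      fix x y assume "x \<in> {x \<in> carrier G. N #> x \<in> T}" "y \<in> {x \<in> carrier G. N #> x \<in> T}"
      thus "x \<otimes> y \<in> {x \<in> carrier G. N #> x \<in> T}"
        using subgroup.m_closed[OF T, of "N #> x" "N #> y"] h.hom_mult[of x y]
        by (simp only: mem_Collect_eq m_closed simp_thms)
    next
      fix x assume "x \<in> {x \<in> carrier G. N #> x \<in> T}"
      thus "inv x \<in> {x \<in> carrier G. N #> x \<in> T}"
        using subgroup.m_inv_closed[OF T, of "N #> x"] h.hom_inv[of x]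
        by (simp only: mem_Collect_eq inv_closed simp_thms)
    qed auto
  next
    fix g x assume g: "g \<in> carrier G" and "x \<in> {x \<in> carrier G. N #> x \<in> T}"
    hence x: "x \<in> carrier G" "N #> x \<in> T" by auto
    have "N #> (g \<otimes> x \<otimes> inv g) = (N #> g) \<otimes>\<^bsub>G Mod N\<^esub> (N #> x) \<otimes>\<^bsub>G Mod N\<^esub> inv\<^bsub>G Mod N\<^esub> (N #> g)"
      using g x by (simp only: h.hom_mult h.hom_inv m_closed inv_closed)
    also have "\<dots> \<in> T"
      by (rule normal.inv_op_closed2[OF assms(2) h.hom_closed[OF g] x(2)])
    finally show "g \<otimes> x \<otimes> inv g \<in> {x \<in> carrier G. N #> x \<in> T}" using g x by simp
  qed
qed

lemma LC_series_normal: "LC_series G i \<lhd> G"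
proof (induction i rule: induct_nat_012)
  case 0 show ?case by (simp add: one_is_normal)
next
  case 1 show ?case by (simp add: LC_normal)
next
  case (ge2 n)
  show ?case
    using preimage_Mod_normal[OF ge2(2) group.LC_normal] normal.factorgroup_is_group[OF ge2(2)]
    by simp
qed

lemma LC_series_subgroup: "subgroup (LC_series G i) G"
  using LC_series_normal normal_imp_subgroup by blast

text \<open>Elements of \<open>LC\<^sub>i(G)\<close> map to the identity of \<open>G/LC\<^sub>i(G)\<close>, and \<open>LC\<close> of the quotient is a subgroup.\<close>

lemma LC_series_mono_Suc: "LC_series G i \<subseteq> LC_series G (Suc i)"
proof (cases i)
  case 0
  show ?thesis using subgroup.one_closed[OF LC_series_subgroup[of 1]] 0 by simp
next
  case (Suc n)
  have "LC_series G i #> x \<in> LC (G Mod LC_series G i)" if "x \<in> LC_series G i" for x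
  proof -
    have "LC_series G i #> x = \<one>\<^bsub>G Mod LC_series G i\<^esub>"
      using coset_join2[OF _ LC_series_subgroup that] subgroup.mem_carrier[OF LC_series_subgroup that]
      by simp
    moreover have "LC (G Mod LC_series G i) \<lhd> G Mod LC_series G i"
      using normal.factorgroup_is_group[OF LC_series_normal] group.LC_normal by blast
    ultimately show ?thesis
      using normal_imp_subgroup subgroup.one_closed by metis
  qed
  thus ?thesis using Suc subgroup.subset[OF LC_series_subgroup] by auto
qed

lemma order_LC_factor:
  "order (LC_factor G (Suc i)) * card (LC_series G i) = card (LC_series G (Suc i))"
  using card_coset_image[OF LC_series_normal LC_series_subgroup LC_series_mono_Suc]
  by (simp add: LC_factor_def order_def carrier_FactGroup r_coset_def)

lemma group_LC_factor: "group (LC_factor G (Suc i))"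
  unfolding LC_factor_def
  using normal.factorgroup_is_group[OF normal_restrict_supergroup[OF LC_series_subgroup
      LC_series_normal LC_series_mono_Suc]] by simp

lemma image_LC_series:
  "(\<lambda>x. LC_series G (Suc i) #> x) ` LC_series G (Suc (Suc i)) = LC (G Mod LC_series G (Suc i))"
proof -
  have "LC (G Mod LC_series G (Suc i)) \<subseteq> carrier (G Mod LC_series G (Suc i))"
    using normal.factorgroup_is_group[OF LC_series_normal] group.LC_normal
      normal_imp_subgroup subgroup.subset by metis
  thus ?thesis by (auto simp: carrier_FactGroup)
qed

lemma LC_series_Suc_eq_carrier:
  assumes "comm_group (G Mod LC_series G (Suc i))"
  shows "LC_series G (Suc (Suc i)) = carrier G"
proof -
  have "LC (G Mod LC_series G (Suc i)) = carrier (G Mod LC_series G (Suc i))"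
    using group.LC_comm_group[OF _ assms] assms comm_group_def by blast
  thus ?thesis by (auto simp: carrier_FactGroup)
qed

text \<open>Passing to \<open>H = G/LC\<^sub>j(G)\<close> turns \<open>LC\<^sub>j\<^sub>+\<^sub>1(G)\<close> into \<open>LC(H)\<close>, and commutators show that \<open>G/LC\<^sub>j\<^sub>+\<^sub>1(G)\<close> is abelian
  once \<open>H/LC(H)\<close> is. But then the series reaches \<open>G\<close> one step too early. For \<open>j = 0\<close> the group \<open>G\<close> itself plays
  the role of \<open>H\<close>, because \<open>LC\<^sub>1(G)\<close> is \<open>LC(G)\<close> by definition and not a preimage.\<close>

lemma no_three_prime_LC_steps:
  assumes fin: "finite (carrier G)"
    and r: "Factorial_Ring.prime r" "card (LC_series G (Suc j)) = r * card (LC_series G j)"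
    and q: "Factorial_Ring.prime q"
      "card (LC_series G (Suc (Suc j))) = q * card (LC_series G (Suc j))"
    and p: "Factorial_Ring.prime p" "order G = p * card (LC_series G (Suc (Suc j)))"
  shows False
proof -
  have pos: "card (LC_series G i) > 0" for i
    using fin LC_series_subgroup subgroup.finite_imp_card_positive by blast
  have "comm_group (G Mod LC_series G (Suc j))"
  proof (cases j)
    case 0
    have "comm_group (G Mod LC G)"
    proof (rule abelian_quotient_by_prime_LC[where p = p and q = q,
          OF fin _ LC_series_normal[of 2]])
      show "LC G \<subseteq> LC_series G 2" using LC_series_mono_Suc[of 1] by (simp add: numeral_2_eq_2)
    qed (use 0 r q p in \<open>simp_all add: numeral_2_eq_2 del: LC_series.simps(3)\<close>)
    thus ?thesis using 0 by simp
  next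
    case (Suc i)
    let ?N = "LC_series G (Suc i)" and ?L = "LC_series G (Suc (Suc i))"
      and ?K = "LC_series G (Suc (Suc (Suc i)))"
    define H where "H = G Mod ?N"
    interpret h: group_hom G H "\<lambda>x. ?N #> x"
      unfolding H_def by (rule group_hom_Mod[OF LC_series_normal])
    have LC: "LC H = (\<lambda>x. ?N #> x) ` ?L" unfolding H_def by (rule image_LC_series[symmetric])
    have finH: "finite (carrier H)" using fin by (simp add: H_def carrier_FactGroup)
    have NL: "?N \<subseteq> ?L" and LK: "?L \<subseteq> ?K" by (rule LC_series_mono_Suc)+
    have cL: "card (LC H) * card ?N = card ?L"
      unfolding LC by (rule card_coset_image[OF LC_series_normal LC_series_subgroup NL])
    have cK: "card ((\<lambda>x. ?N #> x) ` ?K) * card ?N = card ?K"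
      by (rule card_coset_image[OF LC_series_normal LC_series_subgroup]) (use NL LK in blast)
    have cG: "order H * card ?N = order G"
      unfolding H_def by (rule order_Mod[OF LC_series_normal])
    have LCr: "card (LC H) = r" using cL r Suc pos[of "Suc i"] by simp
    have "comm_group (H Mod LC H)"
    proof (rule h.H.abelian_quotient_by_prime_LC[where p = p and q = q, OF finH])
      show "Factorial_Ring.prime (card (LC H))" using LCr r by simp
      show "(\<lambda>x. ?N #> x) ` ?K \<lhd> H"
        unfolding H_def by (rule image_Mod_normal[OF LC_series_normal LC_series_normal])
      show "LC H \<subseteq> (\<lambda>x. ?N #> x) ` ?K" unfolding LC using LK by (rule image_mono)
      have "card ((\<lambda>x. ?N #> x) ` ?K) * card ?N = q * card (LC H) * card ?N"
        using cK cL q Suc by (simp only: mult.assoc)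
      thus "card ((\<lambda>x. ?N #> x) ` ?K) = q * card (LC H)" using pos[of "Suc i"] by simp
      have "order H * card ?N = p * card ((\<lambda>x. ?N #> x) ` ?K) * card ?N"
        using cK cG p Suc by (simp only: mult.assoc)
      thus "order H = p * card ((\<lambda>x. ?N #> x) ` ?K)" using pos[of "Suc i"] by simp
    qed (use p q in simp_all)
    hence comm: "\<forall>u\<in>carrier H. \<forall>v\<in>carrier H. u \<otimes>\<^bsub>H\<^esub> v \<otimes>\<^bsub>H\<^esub> inv\<^bsub>H\<^esub> u \<otimes>\<^bsub>H\<^esub> inv\<^bsub>H\<^esub> v \<in> LC H"
      using h.H.comm_group_Mod_iff[OF h.H.LC_normal] by simp
    have "a \<otimes> b \<otimes> inv a \<otimes> inv b \<in> ?L" if ab: "a \<in> carrier G" "b \<in> carrier G" for a b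
    proof -
      have "?N #> (a \<otimes> b \<otimes> inv a \<otimes> inv b) = (?N #> a) \<otimes>\<^bsub>H\<^esub> (?N #> b)
          \<otimes>\<^bsub>H\<^esub> inv\<^bsub>H\<^esub> (?N #> a) \<otimes>\<^bsub>H\<^esub> inv\<^bsub>H\<^esub> (?N #> b)"
        using ab by (simp only: h.hom_mult h.hom_inv m_closed inv_closed)
      hence "?N #> (a \<otimes> b \<otimes> inv a \<otimes> inv b) \<in> LC H"
        using bspec[OF bspec[OF comm h.hom_closed[OF ab(1)]] h.hom_closed[OF ab(2)]] by (simp only:)
      thus ?thesis using ab by (simp add: H_def)
    qed
    thus ?thesis using comm_group_Mod_iff[OF LC_series_normal] Suc by blast
  qed
  hence "card (LC_series G (Suc (Suc j))) = order G"
    using LC_series_Suc_eq_carrier by (simp add: order_def)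
  thus ?thesis using p(2) prime_gt_1_nat[OF p(1)] pos[of "Suc (Suc j)"] by simp
qed

section \<open>Non-abelian groups of order pq\<close>

text \<open>A second subgroup \<open>U\<close> of order \<open>q\<close> would meet \<open>Q\<close> trivially, and the \<open>q\<^sup>2 > p q\<close> products of \<open>Q\<close> with \<open>U\<close> would
  all be distinct.\<close>

lemma unique_subgroup_of_larger_prime_order:
  assumes fin: "finite (carrier G)" and ord_G: "order G = p * q"
    and q: "Factorial_Ring.prime q" and "p < q"
    and Q: "subgroup Q G" "card Q = q"
  shows "Q = {u \<in> carrier G. u [^] q = \<one>}"
proof
  show "Q \<subseteq> {u \<in> carrier G. u [^] q = \<one>}"
    using Q ord_dvd_card_subgroup[OF Q(1)] subgroup.mem_carrier[OF Q(1)]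
    by (auto simp: pow_eq_id)
next
  show "{u \<in> carrier G. u [^] q = \<one>} \<subseteq> Q"
  proof (rule ccontr)
    assume "\<not> ?thesis"
    then obtain u where u: "u \<in> carrier G" "u [^] q = \<one>" "u \<notin> Q" by blast
    have pQ: "Factorial_Ring.prime (card Q)" using q Q by simp
    define U where "U = generate G {u}"
    have U: "subgroup U G" using u generate_is_subgroup by (simp add: U_def)
    have "u \<noteq> \<one>" using u subgroup.one_closed[OF Q(1)] by blast
    moreover have "ord u dvd q" using u pow_eq_id by blast
    ultimately have "ord u = q" using q u ord_eq_1 by (auto simp: prime_nat_iff)
    hence cU: "card U = q" using generate_pow_card u by (simp add: U_def)
    hence pU: "Factorial_Ring.prime (card U)" using q by simp
    have uU: "u \<in> U" by (simp add: U_def generate.incl)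
    have triv: "v = \<one>" if v: "v \<in> Q" "v \<in> U" for v
    proof (rule ccontr)
      assume "v \<noteq> \<one>"
      then obtain n :: nat where "u = v [^] n"
        using prime_subgroup_powers[OF U pU v(2) _ uU] by blast
      thus False
        using u v(1) subgroup_int_pow_closed[OF Q(1), of v "int n"] by (simp add: int_pow_int)
    qed
    have inj: "x = x' \<and> y = y'"
      if xy: "x \<in> Q" "x' \<in> Q" "y \<in> U" "y' \<in> U" and eq: "x \<otimes> y = x' \<otimes> y'" for x x' y y'
    proof -
      have G: "x \<in> carrier G" "x' \<in> carrier G" "y \<in> carrier G" "y' \<in> carrier G"
        using xy Q(1) U subgroup.mem_carrier by metis+
      have "inv x' \<otimes> x = y' \<otimes> inv y"
        using eq G by (metis inv_closed inv_solve_left inv_solve_right m_assoc m_closed)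
      moreover have "inv x' \<otimes> x \<in> Q" "y' \<otimes> inv y \<in> U"
        using xy Q(1) U by (simp_all add: subgroup.m_closed subgroup.m_inv_closed)
      ultimately have "inv x' \<otimes> x = \<one>" "y' \<otimes> inv y = \<one>" using triv by metis+
      thus ?thesis using G by (metis inv_closed inv_equality inv_inv)
    qed
    have "inj_on (\<lambda>(x, y). x \<otimes> y) (Q \<times> U)"
      unfolding inj_on_def using inj by fast
    hence "card (Q \<times> U) \<le> card (carrier G)"
      using fin Q(1) U by (intro card_inj_on_le) (auto intro: subgroup.mem_carrier)
    hence "q * q \<le> p * q" using Q(2) cU ord_G by (simp add: card_cartesian_product order_def)
    thus False using \<open>p < q\<close> by simp
  qed
qed

text \<open>In fact \<open>LC(G)\<close> is the Sylow \<open>q\<close>-subgroup \<open>Q\<close>. It lies in \<open>LCM(G)\<close> as the set of elements of exponent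
  \<open>q\<close>. All elements outside \<open>Q\<close> have order \<open>p\<close>, and for such an \<open>x\<close> the product of \<open>x\<close> with
  \<open>x\<inverse>c\<close>, where \<open>c\<close> generates \<open>Q\<close>, has order \<open>q\<close> although both factors have order \<open>p\<close>.\<close>

lemma LC_order_pq:
  assumes fin: "finite (carrier G)" and ord_G: "order G = p * q"
    and p: "Factorial_Ring.prime p" and q: "Factorial_Ring.prime q" and "p < q"
    and nc: "\<not> comm_group G"
  shows "card (LC G) = q"
proof -
  obtain Q where Q: "subgroup Q G" "card Q = q"
    using sylow_thm[OF q group_axioms, of 1 p] ord_G fin by (auto simp: mult.commute)
  have Q_def: "Q = {u \<in> carrier G. u [^] q = \<one>}"
    by (rule unique_subgroup_of_larger_prime_order[OF fin ord_G q \<open>p < q\<close> Q])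
  have "Q \<lhd> G"
  proof (rule normal_invI[OF Q(1)])
    fix g u assume "g \<in> carrier G" "u \<in> Q"
    thus "g \<otimes> u \<otimes> inv g \<in> Q" by (subst (asm) Q_def, subst Q_def) (simp add: conj_pow)
  qed
  hence QL: "Q \<subseteq> LCM_set G" by (rule prime_exponent_normal_subset_LCM_set[OF _ q Q_def])
  have ord_p: "ord x = p" if x: "x \<in> carrier G" "x \<notin> Q" for x
  proof -
    have "ord x dvd p * q" using ord_dvd_group_order x ord_G by metis
    then obtain d e where de: "ord x = d * e" "d dvd p" "e dvd q" using division_decomp by blast
    have "\<not> ord x dvd q" using x pow_eq_id Q_def by blast
    moreover have "ord x \<noteq> p * q" using comm_group_if_ord_eq_order[OF fin x(1)] nc ord_G by metis
    moreover have "d = 1 \<or> d = p" "e = 1 \<or> e = q" using de p q by (auto simp: prime_nat_iff)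
    ultimately show ?thesis using de by auto
  qed
  obtain c where c: "c \<in> Q" "c \<noteq> \<one>"
    using prime_subgroup_nontrivial[OF Q(1) q[folded Q(2)]] by blast
  have cG: "c \<in> carrier G" by (rule subgroup.mem_carrier[OF Q(1) c(1)])
  have "LCM_set G \<subseteq> Q"
  proof (rule ccontr)
    assume "\<not> ?thesis"
    then obtain x where x: "x \<in> LCM_set G" "x \<notin> Q" by blast
    have xG: "x \<in> carrier G" using x LCM_set_subset by blast
    have y: "inv x \<otimes> c \<in> carrier G" using xG cG by simp
    have "inv x \<otimes> c \<notin> Q"
    proof
      assume "inv x \<otimes> c \<in> Q"
      hence "c \<otimes> inv (inv x \<otimes> c) \<in> Q" using c Q(1) by (simp add: subgroup.m_closed subgroup.m_inv_closed)
      moreover have "c \<otimes> inv (inv x \<otimes> c) = x"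
        using xG cG by (simp add: inv_mult_group flip: m_assoc)
      ultimately show False using x by simp
    qed
    hence "ord (inv x \<otimes> c) = p" "ord x = p" using ord_p y x xG by simp_all
    moreover have "x \<otimes> (inv x \<otimes> c) = c" using xG cG by (simp flip: m_assoc)
    moreover have "ord c = q" using ord_prime_subgroup[OF Q(1) _ c] Q(2) q by simp
    moreover have "ord (x [^] (1::int) \<otimes> (inv x \<otimes> c)) dvd lcm (ord (x [^] (1::int))) (ord (inv x \<otimes> c))"
      using x(1) y unfolding LCM_set_def by blast
    ultimately have "q dvd p" using xG by simp
    thus False using \<open>p < q\<close> p by (meson dvd_imp_le not_le prime_gt_0_nat)
  qed
  hence "LC G = generate G Q" using QL by (simp add: LC_def)
  also have "\<dots> = Q"
    by (intro subset_antisym generate_subgroup_incl[OF subset_refl Q(1)] subsetI generate.incl)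
  finally show ?thesis using Q by simp
qed

lemma comm_group_nilpotent:
  assumes "comm_group G"
  shows "nilpotent_group G"
proof -
  interpret comm_group G by fact
  have "{x \<otimes> y \<otimes> inv x \<otimes> inv y | x y. x \<in> carrier G \<and> y \<in> carrier G} \<subseteq> {\<one>}"
    using commutator_eq_one_iff m_comm by blast
  from generate_subgroup_incl[OF this triv_subgroup]
  have "lower_central G 1 = {\<one>}" by (auto intro: generate.one)
  thus ?thesis unfolding nilpotent_group_def using is_group by blast
qed

end

section \<open>Groups of maximal LC-class\<close>

theorem theorem1p5:
  fixes G :: "('a, 'b) monoid_scheme" and k :: nat
  assumes "group G" and "finite (carrier G)" and "\<not> comm_group G" and "k > 0"
  shows "maximal_LC_class G k \<longleftrightarrow>
    k = 2 \<and> (\<exists>p q :: nat. Factorial_Ring.prime p \<and> Factorial_Ring.prime q \<and> p < q \<and>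
      order G = p * q \<and> \<not> comm_group G)"
proof -
  interpret group G by fact
  note fin = assms(2) and nc = assms(3)
  show ?thesis
  proof
    assume max: "maximal_LC_class G k"
    define s where "s i = card (LC_series G i)" for i
    define f where "f i = order (LC_factor G (Suc i))" for i
    have prime_f: "Factorial_Ring.prime (f i)" if "i < k" for i
      using max that by (simp add: maximal_LC_class_def f_def)
    have s_Suc: "s (Suc i) = f i * s i" for i
      using order_LC_factor[of i] by (simp add: s_def f_def)
    have s_k: "s k = order G"
      using max by (simp add: maximal_LC_class_def has_LC_class_def s_def order_def)
    have s_0: "s 0 = 1" by (simp add: s_def)
    consider "k = 1" | "k = 2" | j where "k = Suc (Suc (Suc j))"
      using assms(4) by (metis One_nat_def Suc_1 gr0_conv_Suc not0_implies_Suc)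
    thus "k = 2 \<and> (\<exists>p q :: nat. Factorial_Ring.prime p \<and> Factorial_Ring.prime q \<and> p < q \<and>
      order G = p * q \<and> \<not> comm_group G)"
    proof cases
      case 1
      hence "order G = f 0" using s_Suc[of 0] s_0 s_k by simp
      thus ?thesis using prime_order_comm_group prime_f[of 0] nc 1 by simp
    next
      case 2
      have s_1: "s 1 = f 0" using s_Suc[of 0] s_0 by simp
      have ord_G: "order G = f 1 * f 0" using s_Suc[of 1] s_1 s_k 2 by (simp add: numeral_2_eq_2)
      have primes: "Factorial_Ring.prime (f 0)" "Factorial_Ring.prime (f 1)"
        using prime_f 2 by simp_all
      have "f 0 \<noteq> f 1"
        using card_prime_square_comm[OF LC_series_normal[of 1], of "f 0"] s_1 ord_G primes nc
        by (auto simp: s_def)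
      thus ?thesis using 2 primes ord_G nc by (metis linorder_neqE_nat mult.commute)
    next
      case 3
      have "order G = f (Suc (Suc j)) * s (Suc (Suc j))"
        using s_Suc[of "Suc (Suc j)"] s_k 3 by metis
      hence False
        using no_three_prime_LC_steps[OF fin prime_f[of j] s_Suc[of j, unfolded s_def]
            prime_f[of "Suc j"] s_Suc[of "Suc j", unfolded s_def] prime_f[of "Suc (Suc j)"]] 3
        by (simp add: s_def del: LC_series.simps)
      thus ?thesis ..
    qed
  next
    assume "k = 2 \<and> (\<exists>p q :: nat. Factorial_Ring.prime p \<and> Factorial_Ring.prime q \<and> p < q \<and>
      order G = p * q \<and> \<not> comm_group G)"
    then obtain p q :: nat where k: "k = 2" and p: "Factorial_Ring.prime p"
      and q: "Factorial_Ring.prime q" and "p < q" and ord_G: "order G = p * q" by blast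
    have cL: "card (LC_series G 1) = q"
      using LC_order_pq[OF fin ord_G p q \<open>p < q\<close> nc] by simp
    have "order (G Mod LC_series G 1) = p"
      using order_Mod[OF LC_series_normal[of 1]] cL ord_G q by (simp add: prime_gt_0_nat)
    hence "comm_group (G Mod LC_series G (Suc 0))"
      using group.prime_order_comm_group normal.factorgroup_is_group[OF LC_series_normal] p
      by (metis One_nat_def)
    hence top: "LC_series G 2 = carrier G"
      using LC_series_Suc_eq_carrier[of 0] by (simp add: numeral_2_eq_2)
    have f1: "order (LC_factor G 1) = q" using order_LC_factor[of 0] cL by simp
    have f2: "order (LC_factor G 2) = p"
      using order_LC_factor[of 1] cL top ord_G q
      by (simp add: numeral_2_eq_2 order_def prime_gt_0_nat del: LC_series.simps)
    have fac: "Factorial_Ring.prime (order (LC_factor G i)) \<and> nilpotent_group (LC_factor G i)"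
      if "i \<in> {1..2}" for i
    proof -
      have i: "i = 1 \<or> i = 2" using that by auto
      then obtain m where m: "i = Suc m" by (cases i) auto
      have "Factorial_Ring.prime (order (LC_factor G i))" using i f1 f2 p q by auto
      thus ?thesis
        using group.comm_group_nilpotent group.prime_order_comm_group group_LC_factor m by metis
    qed
    have "LC_series G 1 \<noteq> carrier G"
      using cL ord_G p q \<open>p < q\<close> by (auto simp: order_def)
    hence "LC_series G 1 \<subset> LC_series G 2"
      using top subgroup.subset[OF LC_series_subgroup] by blast
    thus "maximal_LC_class G k"
      unfolding maximal_LC_class_def LC_nilpotent_def has_LC_class_def
      using fac top k by (auto intro!: exI[of _ 2])
  qed
qed

end
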